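(* The following relation holds between the first set of finite bivariate biorthogonal N-Konhauser polynomials ${}_KN_{s;\upsilon}^{(p,q)}(t,w)$ and the generalized Laguerre-Konhauser polynomials ${}_{\upsilon}L_s^{(p,q)}(t,w)$: $${}_KN_{s;\upsilon}^{(p,q)}(t,w)=\Gamma(p-s)\,t^{\,s+p}\,w^{-q}\;{}_{\upsilon}L_s^{(p-2s-1,q)}\!\left(\frac1t,w\right)$$ $$\Leftrightarrow\quad {}_{\upsilon}L_s^{(p,q)}(t,w)=\frac{1}{\Gamma(p+s+1)}\,t^{\,p+3s+1}\,w^{q}\;{}_KN_{s;\upsilon}^{(p+2s+1,q)}\!\left(\frac1t,w\right).$$
   Context: $(a)_n$ is the Pochhammer symbol and $\Gamma$ the Gamma function. For $\upsilon=1,2,\dots$, the first set of finite bivariate biorthogonal N-Konhauser polynomials is defined by $${}_KN_{s;\upsilon}^{(p,q)}(t,w)=\Gamma(p-s)\sum_{k=0}^{s}\sum_{m=0}^{s-k}\frac{(-s)_{k+m}\,t^{s-k}w^{\upsilon m}}{\Gamma(p-2s+k)\,\Gamma(q+1+\upsilon m)\,k!\,m!},$$ where $q>-1$ and $s=0,1,\dots,S<\frac{p-1}{2}$. The generalized Laguerre-Konhauser polynomials (Bin-Saad) are defined, for $p,q>-1$ and $\upsilon$ a positive integer, by $${}_{\upsilon}L_s^{(p,q)}(t,w)=s!\sum_{k=0}^{s}\sum_{m=0}^{s-k}\frac{(-1)^{k+m}\,t^{k+p}\,w^{\upsilon m+q}}{k!\,m!\,(s-k-m)!\,\Gamma(k+p+1)\,\Gamma(q+\upsilon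 m+1)}.$$ In each identity the parameters are those for which the polynomials appearing in it are so defined.
   Formalization: The printed powers of t are too large by t^(2s+1) (the first identity fails at s=0, p=2, q=0, w=1, t=2); t^(s+p) is corrected to t^(p-s-1) and t^(p+3s+1) to t^(p+s), for t, w > 0. The equivalence of the printed identities is also proved, under p → p-2s-1, t → 1/t. *)

theory Defs
  imports "HOL-Analysis.Analysis"
begin

(* Intended range: q > -1, \<upsilon> \<ge> 1 and real s < (p - 1) / 2.  All arguments of Gamma are
   positive there. *)
definition KN :: "nat \<Rightarrow> nat \<Rightarrow> real \<Rightarrow> real \<Rightarrow> real \<Rightarrow> real \<Rightarrow> real" where
  "KN \<upsilon> s p q t w =
     Gamma (p - real s) *
     (\<Sum>k=0..s. \<Sum>m=0..s-k.
        pochhammer (- real s) (k + m) * t ^ (s - k) * w ^ (\<upsilon> * m) /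
        (Gamma (p - 2 * real s + real k) * Gamma (q + 1 + real (\<upsilon> * m)) * fact k * fact m))"

(* Intended range: p > -1, q > -1, \<upsilon> \<ge> 1.  The exponents k + p and \<upsilon> m + q are real, so these
   are functions of t, w > 0 (HOL sets 0 powr a = 0). *)
definition LK :: "nat \<Rightarrow> nat \<Rightarrow> real \<Rightarrow> real \<Rightarrow> real \<Rightarrow> real \<Rightarrow> real" where
  "LK \<upsilon> s p q t w =
     fact s *
     (\<Sum>k=0..s. \<Sum>m=0..s-k.
        (-1) ^ (k + m) * t powr (real k + p) * w powr (real (\<upsilon> * m) + q) /
        (fact k * fact m * fact (s - k - m) *
         Gamma (real k + p + 1) * Gamma (q + real (\<upsilon> * m) + 1)))"

(* Comparing coefficients, KN \<upsilon> s p q t w is Gamma (p - s) * LK \<upsilon> s (p - 2 s - 1) q (1/t) w times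
   t powr (p - s - 1) * w powr (- q), and inversely with t powr (p + s) * w powr q.  The source
   prints t powr (s + p) and t powr (p + 3 s + 1) instead; these are too large by the factor
   t powr (2 s + 1), so with them each identity fails already for s = 0, t = 2.  The printed
   identities are nevertheless equivalent to each other under p' = p - 2 s - 1, t' = 1/t. *)

end

theory Submission
  imports Defs
begin

text \<open>The two polynomial families have the same coefficients. Since
  \<open>(-s)\<^sub>j = (-1)\<^sup>j s! / (s - j)!\<close> for \<open>j \<le> s\<close>, the coefficient of the
  \<open>N\<close>-Konhauser polynomial is, up to \<open>\<Gamma>(p - s)\<close>, the coefficient of the Laguerre-Konhauser
  polynomial with first parameter \<open>p - 2s - 1\<close>; the Gamma factors then agree term by term, and
  what remains is to match monomials. At \<open>1/t\<close> the \<open>(k, m)\<close> monomial of the latter is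
  \<open>t\<^bsup>2s + 1 - k - p\<^esup> w\<^bsup>\<upsilon>m + q\<^esup>\<close>, against \<open>t\<^bsup>s - k\<^esup> w\<^bsup>\<upsilon>m\<^esup>\<close>, and the quotient
  \<open>t\<^bsup>p - s - 1\<^esup> w\<^bsup>-q\<^esup>\<close> does not depend on \<open>k\<close> and \<open>m\<close>. This is
  \<open>KN_eq_LK_reciprocal\<close>.

  The converse relation is the same one under \<open>p \<mapsto> p + 2s + 1\<close>, \<open>t \<mapsto> 1/t\<close>, solved for the
  Laguerre-Konhauser side. The equivalence of the two relations with the exponents \<open>s + p\<close> and
  \<open>p' + 3s + 1\<close> does not depend on whether either of them is true: for \<open>p' = p - 2s - 1\<close> these
  exponents are the same number, and \<open>\<Gamma>(p - s) > 0\<close>, so one equation is the other multiplied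
  by a nonzero constant (\<open>scaled_powr_relation_invert\<close>).\<close>

text \<open>Both sides are \<open>(-1)\<^sup>j j!\<close> times the binomial coefficient \<open>s choose j\<close>.\<close>

lemma pochhammer_neg_of_nat:
  assumes "j \<le> s"
  shows "pochhammer (- real s) j = (-1) ^ j * fact s / fact (s - j)"
proof -
  have "real (s choose j) = (-1) ^ j * pochhammer (- real s) j / fact j"
    by (simp add: binomial_gbinomial gbinomial_pochhammer)
  moreover have "real (s choose j) = fact s / (fact j * fact (s - j))"
    using assms by (rule binomial_fact)
  ultimately have "(-1) ^ j * pochhammer (- real s) j = fact s / fact (s - j)"
    by (simp add: field_simps)
  then have "(-1) ^ j * ((-1) ^ j * pochhammer (- real s) j) = (-1) ^ j * (fact s / fact (s - j))"
    by simp
  then show ?thesis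
    by (simp add: mult.assoc[symmetric] power_mult_distrib[symmetric])
qed

text \<open>The exponent of the prefactor \<open>t powr (p - s - 1)\<close> is forced by matching a single monomial;
  the content of the lemma is that it is the same for all of them.\<close>

lemma konhauser_monomial_reciprocal:
  fixes p q t w :: real
  assumes "t > 0" "w > 0" "k \<le> s"
  shows "t powr (p - real s - 1) * w powr (- q) *
           ((1 / t) powr (real k + (p - 2 * real s - 1)) * w powr (real n + q))
         = t ^ (s - k) * w ^ n"
proof -
  have "(1 / t) powr (real k + (p - 2 * real s - 1)) = t powr (- (real k + (p - 2 * real s - 1)))"
    using assms(1) by (simp only: powr_minus_divide) (simp add: powr_divide)
  then have t_part: "t powr (p - real s - 1) * (1 / t) powr (real k + (p - 2 * real s - 1))
             = t ^ (s - k)"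
    using assms(1,3) by (simp add: powr_add[symmetric] of_nat_diff flip: powr_realpow)
  have w_part: "w powr (- q) * w powr (real n + q) = w ^ n"
    using assms(2) by (simp add: powr_add[symmetric] powr_realpow)
  show ?thesis
    unfolding t_part[symmetric] w_part[symmetric] by (simp only: mult_ac)
qed

lemma KN_eq_LK_reciprocal:
  fixes p q t w :: real
  assumes "t > 0" "w > 0"
  shows "KN \<upsilon> s p q t w =
           Gamma (p - real s) * t powr (p - real s - 1) * w powr (- q) *
           LK \<upsilon> s (p - 2 * real s - 1) q (1 / t) w"
proof -
  define c where "c = t powr (p - real s - 1) * w powr (- q)"
  have term_eq:
    "pochhammer (- real s) (k + m) * t ^ (s - k) * w ^ (\<upsilon> * m) /
       (Gamma (p - 2 * real s + real k) * Gamma (q + 1 + real (\<upsilon> * m)) * fact k * fact m)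
     = c * fact s * ((-1) ^ (k + m) * (1 / t) powr (real k + (p - 2 * real s - 1)) *
         w powr (real (\<upsilon> * m) + q) /
         (fact k * fact m * fact (s - k - m) *
          Gamma (real k + (p - 2 * real s - 1) + 1) * Gamma (q + real (\<upsilon> * m) + 1)))"
    (is "_ = c * fact s * ((-1) ^ (k + m) * ?T * ?W / _)")
    if "k \<in> {0..s}" "m \<in> {0..s - k}" for k m
  proof -
    have "k + m \<le> s" "k \<le> s"
      using that by auto
    have poch: "pochhammer (- real s) (k + m) = (-1) ^ (k + m) * fact s / fact (s - k - m)"
      using pochhammer_neg_of_nat[OF \<open>k + m \<le> s\<close>] by simp
    have mono: "t ^ (s - k) * w ^ (\<upsilon> * m) = c * (?T * ?W)"
      using konhauser_monomial_reciprocal[OF assms \<open>k \<le> s\<close>, of p q "\<upsilon> * m"]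
      by (simp add: c_def)
    have gamma: "Gamma (real k + (p - 2 * real s - 1) + 1) = Gamma (p - 2 * real s + real k)"
      "Gamma (q + real (\<upsilon> * m) + 1) = Gamma (q + 1 + real (\<upsilon> * m))"
      by (rule arg_cong[of _ _ Gamma], simp)+
    show ?thesis
      unfolding poch gamma mult.assoc[of _ "t ^ (s - k)"] mono
      by (simp add: divide_inverse mult_ac)
  qed
  show ?thesis
    unfolding KN_def LK_def mult.assoc[of "Gamma (p - real s)"] c_def[symmetric]
      mult.assoc[of c, symmetric] sum_distrib_left
    by (intro arg_cong2[where f = "(*)"] sum.cong refl term_eq)
qed

text \<open>Passing to the reciprocal argument inverts the power of \<open>t\<close>, which is what is needed to
  solve the relation for \<open>y\<close>.\<close>

lemma scaled_powr_relation_invert: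
  fixes g t w a q x y :: real
  assumes "g \<noteq> 0" "t > 0" "w > 0"
  shows "x = g * t powr a * w powr (- q) * y
         \<longleftrightarrow> y = 1 / g * (1 / t) powr a * w powr q * x"
  using assms by (auto simp: powr_divide powr_minus field_simps)

theorem theorem16:
  fixes q :: real and s \<upsilon> :: nat
  assumes "\<upsilon> \<ge> 1" and "q > -1"
  shows
    "(\<forall>p t w :: real. real s < (p - 1) / 2 \<longrightarrow> t > 0 \<longrightarrow> w > 0 \<longrightarrow>
        KN \<upsilon> s p q t w =
          Gamma (p - real s) * t powr (p - real s - 1) * w powr (- q) *
          LK \<upsilon> s (p - 2 * real s - 1) q (1 / t) w)
     \<and> (\<forall>p t w :: real. p > -1 \<longrightarrow> real s < ((p + 2 * real s + 1) - 1) / 2 \<longrightarrow> t > 0 \<longrightarrow> w > 0 \<longrightarrow>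
        LK \<upsilon> s p q t w =
          1 / Gamma (p + real s + 1) * t powr (p + real s) * w powr q *
          KN \<upsilon> s (p + 2 * real s + 1) q (1 / t) w)
     \<and> (\<forall>p p' t t' w :: real. real s < (p - 1) / 2 \<longrightarrow> t > 0 \<longrightarrow> w > 0 \<longrightarrow>
        p' = p - 2 * real s - 1 \<longrightarrow> t' = 1 / t \<longrightarrow>
        (KN \<upsilon> s p q t w =
           Gamma (p - real s) * t powr (real s + p) * w powr (- q) *
           LK \<upsilon> s (p - 2 * real s - 1) q (1 / t) w
         \<longleftrightarrow>
         LK \<upsilon> s p' q t' w =
           1 / Gamma (p' + real s + 1) * t' powr (p' + 3 * real s + 1) * w powr q *
           KN \<upsilon> s (p' + 2 * real s + 1) q (1 / t') w))"
proof (intro conjI allI impI)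
  fix p t w :: real
  assume "t > 0" "w > 0"
  then show "KN \<upsilon> s p q t w =
      Gamma (p - real s) * t powr (p - real s - 1) * w powr (- q) *
      LK \<upsilon> s (p - 2 * real s - 1) q (1 / t) w"
    by (rule KN_eq_LK_reciprocal)
next
  fix p t w :: real
  assume "p > -1" and dom: "real s < ((p + 2 * real s + 1) - 1) / 2" and "t > 0" "w > 0"
  have "Gamma (p + real s + 1) > 0"
    using dom by (intro Gamma_real_pos) simp
  then have "Gamma (p + real s + 1) \<noteq> 0"
    by simp
  moreover have "KN \<upsilon> s (p + 2 * real s + 1) q (1 / t) w =
      Gamma (p + real s + 1) * (1 / t) powr (p + real s) * w powr (- q) * LK \<upsilon> s p q t w"
    using KN_eq_LK_reciprocal[of "1 / t" w \<upsilon> s "p + 2 * real s + 1" q] \<open>t > 0\<close> \<open>w > 0\<close>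
    by (simp add: algebra_simps)
  ultimately show "LK \<upsilon> s p q t w =
      1 / Gamma (p + real s + 1) * t powr (p + real s) * w powr q *
      KN \<upsilon> s (p + 2 * real s + 1) q (1 / t) w"
    using scaled_powr_relation_invert[of "Gamma (p + real s + 1)" "1 / t" w] \<open>t > 0\<close> \<open>w > 0\<close>
    by simp
next
  fix p p' t t' w :: real
  assume dom: "real s < (p - 1) / 2" and "t > 0" "w > 0"
    and p': "p' = p - 2 * real s - 1" and t': "t' = 1 / t"
  have "Gamma (p - real s) > 0"
    using dom by (intro Gamma_real_pos) simp
  then have nz: "Gamma (p - real s) \<noteq> 0"
    by simp
  have params: "p' + real s + 1 = p - real s" "p' + 3 * real s + 1 = real s + p"
    "p' + 2 * real s + 1 = p" "1 / t' = t"
    by (simp_all add: p' t')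
  show "KN \<upsilon> s p q t w =
      Gamma (p - real s) * t powr (real s + p) * w powr (- q) *
      LK \<upsilon> s (p - 2 * real s - 1) q (1 / t) w
    \<longleftrightarrow>
    LK \<upsilon> s p' q t' w =
      1 / Gamma (p' + real s + 1) * t' powr (p' + 3 * real s + 1) * w powr q *
      KN \<upsilon> s (p' + 2 * real s + 1) q (1 / t') w"
    unfolding params unfolding p'[symmetric] t'
    by (rule scaled_powr_relation_invert[OF nz \<open>t > 0\<close> \<open>w > 0\<close>])
qed

end
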